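(* For every integer $k\ge 0$ and every graph $G$ of treewidth at most $k$, we have $\pi^*(G)\le 4^k$.
   Context: All graphs are finite and simple. A lazy walk in a graph $G$ is a sequence of vertices $v_1,\dots,v_m$ such that for each $i<m$, either $v_iv_{i+1}\in E(G)$ or $v_i=v_{i+1}$. For a colouring $\phi$ of $V(G)$, a lazy walk $v_1,\dots,v_{2t}$ is $\phi$-repetitive if $\phi(v_i)=\phi(v_{i+t})$ for each $i\in\{1,\dots,t\}$. A colouring $\phi$ is strongly nonrepetitive if for every $\phi$-repetitive lazy walk $v_1,\dots,v_{2t}$ there exists $i\in\{1,\dots,t\}$ with $v_i=v_{i+t}$. $\pi^*(G)$ denotes the minimum number of colours in a strongly nonrepetitive colouring of $G$. *)

theory Defs
  imports Main
begin

definition simple_graph :: "'a set \<Rightarrow> ('a \<Rightarrow> 'a \<Rightarrow> bool) \<Rightarrow> bool" where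
  "simple_graph V E \<longleftrightarrow> finite V \<and> (\<forall>u v. E u v \<longrightarrow> u \<in> V \<and> v \<in> V)
     \<and> (\<forall>u v. E u v \<longrightarrow> E v u) \<and> (\<forall>u. \<not> E u u)"

definition connected_on :: "'a set \<Rightarrow> ('a \<Rightarrow> 'a \<Rightarrow> bool) \<Rightarrow> bool" where
  "connected_on S E \<longleftrightarrow>
     (\<forall>x\<in>S. \<forall>y\<in>S. (\<lambda>a b. a \<in> S \<and> b \<in> S \<and> E a b)\<^sup>*\<^sup>* x y)"

definition is_cycle :: "'a set \<Rightarrow> ('a \<Rightarrow> 'a \<Rightarrow> bool) \<Rightarrow> 'a list \<Rightarrow> bool" where
  "is_cycle V E c \<longleftrightarrow> length c \<ge> 3 \<and> distinct c \<and> set c \<subseteq> V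
     \<and> (\<forall>i. Suc i < length c \<longrightarrow> E (c ! i) (c ! Suc i)) \<and> E (last c) (hd c)"

definition is_tree :: "'b set \<Rightarrow> ('b \<Rightarrow> 'b \<Rightarrow> bool) \<Rightarrow> bool" where
  "is_tree T TE \<longleftrightarrow> simple_graph T TE \<and> T \<noteq> {} \<and> connected_on T TE
     \<and> (\<nexists>c. is_cycle T TE c)"

definition tree_decomposition ::
  "'a set \<Rightarrow> ('a \<Rightarrow> 'a \<Rightarrow> bool) \<Rightarrow> 'b set \<Rightarrow> ('b \<Rightarrow> 'b \<Rightarrow> bool) \<Rightarrow> ('b \<Rightarrow> 'a set) \<Rightarrow> bool" where
  "tree_decomposition V E T TE B \<longleftrightarrow> is_tree T TE
     \<and> (\<forall>x\<in>T. B x \<subseteq> V)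
     \<and> (\<forall>v\<in>V. \<exists>x\<in>T. v \<in> B x)
     \<and> (\<forall>u v. E u v \<longrightarrow> (\<exists>x\<in>T. u \<in> B x \<and> v \<in> B x))
     \<and> (\<forall>v\<in>V. connected_on {x\<in>T. v \<in> B x} TE)"

text \<open>Treewidth: least w such that some tree decomposition has all bags of size at most w+1.
  Tree nodes are taken to be natural numbers (any finite tree is isomorphic to one on nat).\<close>
definition treewidth :: "'a set \<Rightarrow> ('a \<Rightarrow> 'a \<Rightarrow> bool) \<Rightarrow> nat" where
  "treewidth V E = (LEAST w. \<exists>(T::nat set) TE B. tree_decomposition V E T TE B
                         \<and> (\<forall>x\<in>T. card (B x) \<le> w + 1))"

definition lazy_walk :: "'a set \<Rightarrow> ('a \<Rightarrow> 'a \<Rightarrow> bool) \<Rightarrow> 'a list \<Rightarrow> bool" where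
  "lazy_walk V E ws \<longleftrightarrow> set ws \<subseteq> V
     \<and> (\<forall>i. Suc i < length ws \<longrightarrow> (E (ws ! i) (ws ! Suc i) \<or> ws ! i = ws ! Suc i))"

definition repetitive :: "('a \<Rightarrow> 'c) \<Rightarrow> 'a list \<Rightarrow> bool" where
  "repetitive \<phi> ws \<longleftrightarrow> (\<exists>t. t \<ge> 1 \<and> length ws = 2 * t
     \<and> (\<forall>i<t. \<phi> (ws ! i) = \<phi> (ws ! (i + t))))"

definition strongly_nonrepetitive ::
  "'a set \<Rightarrow> ('a \<Rightarrow> 'a \<Rightarrow> bool) \<Rightarrow> ('a \<Rightarrow> 'c) \<Rightarrow> bool" where
  "strongly_nonrepetitive V E \<phi> \<longleftrightarrow>
     (\<forall>ws. lazy_walk V E ws \<and> repetitive \<phi> ws \<longrightarrow>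
        (let t = length ws div 2 in \<exists>i<t. ws ! i = ws ! (i + t)))"

definition pi_star :: "'a set \<Rightarrow> ('a \<Rightarrow> 'a \<Rightarrow> bool) \<Rightarrow> nat" where
  "pi_star V E = (LEAST n. \<exists>\<phi> :: 'a \<Rightarrow> nat. \<phi> ` V \<subseteq> {..<n} \<and> strongly_nonrepetitive V E \<phi>)"

end

(*
  Vertices sharing a bag of a tree decomposition form a chordal graph: it has an elimination order in
  which the earlier neighbours of each vertex form a clique of size at most k.  Put a vertex without
  earlier neighbours in layer 0, and any other vertex one layer above its lowest earlier neighbour.
  Within a layer there are at most k - 1 earlier neighbours, so by induction on k the layers can be
  coloured with 4^(k-1) colours; take the product with a strongly nonrepetitive 4-colouring of the
  path of layers.  Along a repetitive lazy walk the layers of corresponding vertices then agree.  By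
  chordality, deleting all vertices above the lowest layer that occurs leaves a lazy walk, to which
  the colouring inside that layer applies.
  The path is coloured by a square-free word whose letters at distance two differ: a walk that does
  not stand still or turn back is straight, and every other walk can be shortened in both halves
  simultaneously.
*)
theory Submission
  imports Defs
begin

section \<open>A square-free word on four letters without factors of the form aba\<close>

text \<open>The Thue-Morse word: the parity of the number of ones in the binary expansion of
  \<open>n\<close>.\<close>

fun thue_morse :: "nat \<Rightarrow> bool" where
  "thue_morse n = (if n = 0 then False else odd n \<noteq> thue_morse (n div 2))"

declare thue_morse.simps [simp del]

lemma thue_morse_double: "thue_morse (2 * n) = thue_morse n"
  by (cases "n = 0") (simp_all add: thue_morse.simps[of "2 * n"])

lemma thue_morse_Suc_double: "thue_morse (Suc (2 * n)) = (\<not> thue_morse n)"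
  by (simp add: thue_morse.simps[of "Suc (2 * n)"])

lemma thue_morse_even_neq: "even n \<Longrightarrow> thue_morse (Suc n) \<noteq> thue_morse n"
  using thue_morse_double thue_morse_Suc_double by (auto elim!: evenE)

text \<open>An overlap of even period \<open>2 * q\<close>, restricted to the positions of the same
  parity as \<open>i\<close>, becomes after halving an overlap of period \<open>q\<close>; odd
  periods are excluded directly. The bound \<open>j \<le> i + p\<close> is inclusive: an overlap is
  a square together with one more letter.\<close>

lemma thue_morse_overlap_free:
  assumes "p > 0"
  shows "\<exists>j. i \<le> j \<and> j \<le> i + p \<and> thue_morse j \<noteq> thue_morse (j + p)"
  using assms
proof (induction p arbitrary: i rule: less_induct)
  case (less p)
  show ?case
  proof (rule ccontr)
    assume "\<not> ?case"
    then have eq: "thue_morse j = thue_morse (j + p)" if "i \<le> j" "j \<le> i + p" for j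
      using that by blast
    show False
    proof (cases "even p")
      case True
      then obtain q where q: "p = 2 * q" by (elim evenE)
      with less.prems have "q < p" "q > 0" by auto
      from less.IH[OF this, of "i div 2"] obtain j where
        j: "i div 2 \<le> j" "j \<le> i div 2 + q" "thue_morse j \<noteq> thue_morse (j + q)" by blast
      show False
      proof (cases "even i")
        case True
        with j q have "i \<le> 2 * j" "2 * j \<le> i + p" by auto
        from eq[OF this] have "thue_morse (2 * j) = thue_morse (2 * (j + q))"
          by (simp add: q algebra_simps)
        with j(3) show False by (simp only: thue_morse_double)
      next
        case False
        with j q have "i \<le> Suc (2 * j)" "Suc (2 * j) \<le> i + p" by presburger+
        from eq[OF this] have "thue_morse (Suc (2 * j)) = thue_morse (Suc (2 * (j + q)))"
          by (simp add: q algebra_simps)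
        with j(3) show False by (simp only: thue_morse_Suc_double) simp
      qed
    next
      case False
      \<comment> \<open>One of \<open>j\<close> and \<open>j + p\<close> is even, so the word alternates along an interval of odd
        length \<open>p\<close> whose two ends carry the same letter.\<close>
      have alt: "thue_morse (Suc j) \<noteq> thue_morse j" if "i \<le> j" "j < i + p" for j
      proof (cases "even j")
        case True
        then show ?thesis by (rule thue_morse_even_neq)
      next
        case odd: False
        with False have "thue_morse (Suc (j + p)) \<noteq> thue_morse (j + p)"
          by (intro thue_morse_even_neq) simp
        with eq[of j] eq[of "Suc j"] that show ?thesis by simp
      qed
      have "n \<le> p \<Longrightarrow> thue_morse (i + n) = (thue_morse i \<noteq> odd n)" for n
      proof (induction n)
        case (Suc n)
        with alt[of "i + n"] show ?case by auto
      qed simp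
      from this[of p] eq[of i] False show False by simp
    qed
  qed
qed

text \<open>The letters 0, 1, 2 encode the differences 0, -1, 1 between consecutive Thue-Morse
  letters.\<close>

definition ternary_word :: "nat \<Rightarrow> nat" where
  "ternary_word n = (if thue_morse n = thue_morse (Suc n) then 0 else if thue_morse n then 1 else 2)"

lemma ternary_word_less: "ternary_word n < 3"
  by (simp add: ternary_word_def)

lemma ternary_word_square_free:
  assumes "p > 0"
  shows "\<exists>j. i \<le> j \<and> j < i + p \<and> ternary_word j \<noteq> ternary_word (j + p)"
proof (rule ccontr)
  assume "\<not> ?thesis"
  then have eq: "ternary_word j = ternary_word (j + p)" if "i \<le> j" "j < i + p" for j
    using that by blast
  \<comment> \<open>The ternary word is the difference sequence of the Thue--Morse word, hence the Thue--Morse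
    words starting at \<open>i\<close> and at \<open>i + p\<close> agree as soon as they agree in one place.\<close>
  have diff: "(of_bool (thue_morse j) :: int) - of_bool (thue_morse (j + p)) =
      of_bool (thue_morse (Suc j)) - of_bool (thue_morse (Suc (j + p)))" if "i \<le> j" "j < i + p" for j
    using eq[OF that] by (auto simp: ternary_word_def split: if_splits)
  have const: "n \<le> p \<Longrightarrow> (of_bool (thue_morse (i + n)) :: int) - of_bool (thue_morse (i + n + p)) =
      of_bool (thue_morse i) - of_bool (thue_morse (i + p))" for n
  proof (induction n)
    case (Suc n)
    with diff[of "i + n"] show ?case by simp
  qed simp
  obtain j where j: "i \<le> j" "j \<le> i + p" "thue_morse j \<noteq> thue_morse (j + p)"
    using thue_morse_overlap_free[OF assms] by blast
  then obtain n where "j = i + n" "n \<le> p" by (auto simp: le_iff_add)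
  \<comment> \<open>The difference is nonzero and takes the same value at \<open>i\<close> and at
    \<open>i + p\<close>. The letter at \<open>i + p\<close> would then have to be both 0 and 1,
    since it is subtracted in one difference and subtracted from in the other.\<close>
  with const[of n] const[of p] j(3) show False
    by (auto simp: of_bool_def split: if_splits)
qed

text \<open>The ternary word with a separator 3 inserted after every two letters. Its
  \<open>m\<close>-th ternary letter therefore sits at position
  \<open>3 * (m div 2) + m mod 2\<close>. The separators destroy all factors of the form
  aba.\<close>

definition path_word :: "nat \<Rightarrow> nat" where
  "path_word n = (if n mod 3 = 2 then 3 else ternary_word (2 * (n div 3) + n mod 3))"

lemma path_word_less: "path_word n < 4"
  using ternary_word_less[of "2 * (n div 3) + n mod 3"] by (simp add: path_word_def)

lemma path_word_eq_3: "path_word n = 3 \<longleftrightarrow> n mod 3 = 2"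
  using ternary_word_less[of "2 * (n div 3) + n mod 3"] by (auto simp: path_word_def)

lemma path_word_ternary: "path_word (3 * (m div 2) + m mod 2) = ternary_word m"
proof -
  have "m mod 2 < 3" by (rule less_trans[of _ 2]) simp_all
  then have "(3 * (m div 2) + m mod 2) mod 3 = m mod 2" "(3 * (m div 2) + m mod 2) div 3 = m div 2"
    by simp_all
  moreover have "m mod 2 \<noteq> 2" by presburger
  ultimately show ?thesis by (simp add: path_word_def)
qed

section \<open>Nearby letters and squares in the four-letter word\<close>

lemma ternary_word_Suc_neq: "ternary_word (Suc n) \<noteq> ternary_word n"
  using ternary_word_square_free[of 1 n] by (auto simp: le_less_Suc_eq)

lemma path_word_Suc_neq: "path_word (Suc n) \<noteq> path_word n"
proof (cases "n mod 3 = 0")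
  case True
  then have "Suc n mod 3 = 1" "Suc n div 3 = n div 3" by presburger+
  with True show ?thesis using ternary_word_Suc_neq[of "2 * (n div 3)"] by (simp add: path_word_def)
next
  case False
  then have "n mod 3 = 2 \<longleftrightarrow> Suc n mod 3 \<noteq> 2" by presburger
  then show ?thesis using path_word_eq_3 by metis
qed

lemma path_word_Suc_Suc_neq: "path_word (Suc (Suc n)) \<noteq> path_word n"
proof (cases "n mod 3 = 1")
  case True
  then have "Suc (Suc n) mod 3 = 0" "Suc (Suc n) div 3 = Suc (n div 3)" by presburger+
  with True show ?thesis using ternary_word_Suc_neq[of "Suc (2 * (n div 3))"]
    by (simp add: path_word_def)
next
  case False
  then have "n mod 3 = 2 \<longleftrightarrow> Suc (Suc n) mod 3 \<noteq> 2" by presburger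
  then show ?thesis using path_word_eq_3 by metis
qed

text \<open>Any three consecutive positions contain a separator, so a square of period at least 3
  has a period divisible by 3. Erasing the separators then leaves a square in the ternary
  word.\<close>

lemma path_word_square_free:
  assumes "p > 0"
  shows "\<exists>j. i \<le> j \<and> j < i + p \<and> path_word j \<noteq> path_word (j + p)"
proof (rule ccontr)
  assume "\<not> ?thesis"
  then have eq: "path_word j = path_word (j + p)" if "i \<le> j" "j < i + p" for j
    using that by blast
  have "p \<noteq> 1" "p \<noteq> 2"
    using eq[of i] path_word_Suc_neq[of i] path_word_Suc_Suc_neq[of i] by auto
  with assms have "p \<ge> 3" by linarith
  define j where "j = 3 * (i div 3) + 2"
  have j: "i \<le> j" "j < i + 3" "j mod 3 = 2" unfolding j_def by presburger+
  then have "(j + p) mod 3 = 2"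
    using eq[of j] path_word_eq_3[of j] path_word_eq_3[of "j + p"] \<open>p \<ge> 3\<close> by simp
  with j(3) have "p mod 3 = 0" by presburger
  then obtain q where q: "p = 3 * q" by auto
  with assms have "2 * q > 0" by simp
  \<comment> \<open>The starting index is the number of ternary letters before position
    \<open>i\<close>; a window of length \<open>3 * q\<close> contains \<open>2 * q\<close> of
    them.\<close>
  from ternary_word_square_free[OF this, of "2 * (i div 3) + i mod 3"] obtain m where
    m: "2 * (i div 3) + i mod 3 \<le> m" "m < 2 * (i div 3) + i mod 3 + 2 * q"
      "ternary_word m \<noteq> ternary_word (m + 2 * q)" by blast
  define l where "l = 3 * (m div 2) + m mod 2"
  obtain a b where ab: "m = 2 * a + b" "b < 2" "m div 2 = a" "m mod 2 = b"
    by (rule that[of "m div 2" "m mod 2"]) simp_all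
  obtain s r where sr: "i = 3 * s + r" "r < 3" "i div 3 = s" "i mod 3 = r"
    by (rule that[of "i div 3" "i mod 3"]) simp_all
  from ab(2) sr(2) have "b = 0 \<or> b = 1" "r = 0 \<or> r = 1 \<or> r = 2" by auto
  then have "i \<le> l" "l < i + p"
    using m(1,2) unfolding q l_def ab(3,4) sr(3,4) unfolding ab(1) sr(1) by (elim disjE; simp)+
  from eq[OF this] have "path_word l = path_word (l + p)" .
  moreover have "l + p = 3 * ((m + 2 * q) div 2) + (m + 2 * q) mod 2"
    by (simp add: l_def q)
  ultimately show False
    using m(3) path_word_ternary[of m] path_word_ternary[of "m + 2 * q"] by (metis l_def)
qed

section \<open>Lazy walks on a path\<close>

definition path_adj :: "nat \<Rightarrow> nat \<Rightarrow> bool" where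
  "path_adj a b \<longleftrightarrow> a = b \<or> a = Suc b \<or> b = Suc a"

lemma path_adj_sym: "path_adj a b \<Longrightarrow> path_adj b a"
  by (auto simp: path_adj_def)

lemma path_word_eq_imp_eq:
  assumes "path_word a = path_word b" "a \<le> b + 2" "b \<le> a + 2"
  shows "a = b"
proof -
  consider "a = b" | "a = Suc b" | "a = Suc (Suc b)" | "b = Suc a" | "b = Suc (Suc a)"
    using assms(2,3) by linarith
  then show ?thesis
    using assms(1) path_word_Suc_neq path_word_Suc_Suc_neq by cases metis+
qed

lemma path_word_adj_imp_eq: "path_word a = path_word b \<Longrightarrow> path_adj a b \<Longrightarrow> a = b"
  using path_word_eq_imp_eq[of a b] by (auto simp: path_adj_def)

lemma path_word_adj_adj_imp_eq:
  "path_word a = path_word b \<Longrightarrow> path_adj a c \<Longrightarrow> path_adj c b \<Longrightarrow> a = b"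
  using path_word_eq_imp_eq[of a b] by (auto simp: path_adj_def)

text \<open>The numerical bounds say that the end of \<open>f\<close> is adjacent to the start
  \<open>c\<close> of \<open>g\<close>. Two walks running against each other must come to distance 1
  or 2 at some common time, and letters that close differ.\<close>

lemma path_word_antiparallel:
  assumes "\<And>i. i < t \<Longrightarrow> f i = a + i" "\<And>i. i < t \<Longrightarrow> g i + i = c"
    and "a + t \<le> c + 2" "c \<le> a + t" "t \<ge> 2"
  shows "\<exists>i<t. path_word (f i) \<noteq> path_word (g i)"
proof (rule ccontr)
  assume "\<not> ?thesis"
  then have eq: "path_word (f i) = path_word (g i)" if "i < t" for i
    using that by blast
  \<comment> \<open>Before time \<open>i\<close> both walks approach each other by two per step, so
    the gap \<open>c - a\<close> has shrunk to 1 or 2. If the gap is zero from the start, one step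
    opens it to 2.\<close>
  define i where "i = (if c = a then 1 else (c - a - 1) div 2)"
  have "i < t" using assms(3-5) by (auto simp: i_def)
  moreover have "f i \<noteq> g i \<and> f i \<le> g i + 2 \<and> g i \<le> f i + 2"
  proof (cases "c = a")
    case True
    with assms(1,2)[OF \<open>i < t\<close>] show ?thesis by (simp add: i_def)
  next
    case False
    define m where "m = c - a - 1"
    have "c = a + m + 1" using False assms(3,5) by (simp add: m_def)
    moreover have "i = m div 2" using False by (simp add: i_def m_def)
    moreover have "2 * (m div 2) \<le> m \<and> m \<le> 2 * (m div 2) + 1" by linarith
    ultimately show ?thesis
      using assms(1,2)[OF \<open>i < t\<close>] by linarith
  qed
  ultimately show False
    using eq path_word_eq_imp_eq by blast
qed

text \<open>If \<open>c\<close> lies above \<open>a\<close>, the distance is at most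
  \<open>t\<close>, so the equal letters form a square of period \<open>c - a\<close>. Otherwise the
  bounds leave \<open>a\<close> and \<open>c\<close> so close that equal first letters force
  equality.\<close>

lemma path_word_parallel_up:
  assumes "\<And>i. i < t \<Longrightarrow> path_word (a + i) = path_word (c + i)"
    and "a + t \<le> c + 2" "c \<le> a + t" "t \<ge> 1"
  shows "a = c"
proof (cases "c > a")
  case True
  then obtain p where p: "c = a + p" "p > 0" by (auto simp: less_iff_Suc_add)
  obtain j where "a \<le> j" "j < a + p" "path_word j \<noteq> path_word (j + p)"
    using path_word_square_free[OF p(2)] by blast
  moreover from this obtain i where "j = a + i" by (auto simp: le_iff_add)
  ultimately show ?thesis
    using assms(1)[of i] assms(3) p(1) by (simp add: ac_simps)
next
  case False
  then show ?thesis
    using assms(1)[of 0] assms(2,4) path_word_eq_imp_eq[of a c] by simp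
qed

text \<open>Reading both walks backwards turns them into upward walks and exchanges their
  roles.\<close>

lemma path_word_parallel_down:
  assumes "\<And>i. i < t \<Longrightarrow> f i + i = a" "\<And>i. i < t \<Longrightarrow> g i + i = c"
    and "\<And>i. i < t \<Longrightarrow> path_word (f i) = path_word (g i)"
    and "c + t \<le> a + 2" "a \<le> c + t" "t \<ge> 1"
  shows "a = c"
proof -
  define r where "r = t - 1"
  have r: "t = Suc r" using assms(6) by (simp add: r_def)
  have "path_word (g r + i) = path_word (f r + i)" if "i < t" for i
  proof -
    have "r - i < t" "r < t" using r by auto
    then have "g r + i = g (r - i)" "f r + i = f (r - i)"
      using assms(1)[of "r - i"] assms(1)[of r] assms(2)[of "r - i"] assms(2)[of r] r that by auto
    with assms(3)[OF \<open>r - i < t\<close>] show ?thesis by simp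
  qed
  moreover have "f r + r = a" "g r + r = c" using assms(1,2) r by auto
  ultimately show ?thesis
    using path_word_parallel_up[of t "g r" "f r"] assms(4-6) by auto
qed

lemma straight_walk:
  fixes f :: "nat \<Rightarrow> nat"
  assumes adj: "\<And>i. Suc i < t \<Longrightarrow> path_adj (f i) (f (Suc i))"
    and "\<And>i. Suc i < t \<Longrightarrow> f i \<noteq> f (Suc i)"
    and "\<And>i. Suc (Suc i) < t \<Longrightarrow> f i \<noteq> f (Suc (Suc i))"
  shows "\<exists>a. (\<forall>i<t. f i = a + i) \<or> (\<forall>i<t. f i + i = a)"
  using assms
proof (induction t)
  case (Suc t)
  then obtain a where IH: "(\<forall>i<t. f i = a + i) \<or> (\<forall>i<t. f i + i = a)" by auto
  show ?case
  proof (cases t)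
    case 0
    then show ?thesis by (intro exI[of _ "f 0"]) simp
  next
    case t: (Suc s)
    have step: "f t = Suc (f s) \<or> f s = Suc (f t)"
      using Suc.prems(1,2)[of s] t by (auto simp: path_adj_def)
    have "f t = a + t \<and> (\<forall>i<t. f i = a + i) \<or> f t + t = a \<and> (\<forall>i<t. f i + i = a)"
    proof (cases s)
      case 0
      \<comment> \<open>With only one earlier position both alternatives hold, and the new step
        decides the direction.\<close>
      with t have "f s = a" using IH by auto
      with t step 0 show ?thesis by auto
    next
      case s: (Suc r)
      have "f r \<noteq> f t" using Suc.prems(3)[of r] s t by simp
      have rs: "r < t" "s < t" "s = Suc r" "t = Suc s" using s t by auto
      from IH show ?thesis
      proof
        assume up: "\<forall>i<t. f i = a + i"
        with rs have "f r = a + r" "f s = a + s" by blast+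
        with step \<open>f r \<noteq> f t\<close> rs have "f t = a + t" by auto
        with up show ?thesis by blast
      next
        assume down: "\<forall>i<t. f i + i = a"
        with rs have "f r + r = a" "f s + s = a" by blast+
        with step \<open>f r \<noteq> f t\<close> rs have "f t + t = a" by auto
        with down show ?thesis by blast
      qed
    qed
    then show ?thesis by (intro exI[of _ a]) (auto simp: less_Suc_eq)
  qed
qed simp

section \<open>Shortening walks that stand still or turn back\<close>

lemma successively_infix: "successively P (xs @ ys @ zs) \<Longrightarrow> successively P ys"
  by (simp add: successively_append_iff)

lemma successively_contract:
  assumes "successively P (xs @ [a] @ ys @ [a] @ zs)"
  shows "successively P (xs @ [a] @ zs)"
  using successively_infix[of P "[]" "xs @ [a]" "ys @ [a] @ zs"]
    successively_infix[of P "xs @ [a] @ ys" "[a] @ zs" "[]"] assms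
  by (auto simp: successively_append_iff)

text \<open>The list \<open>zs\<close> pairs each vertex of the first half with its partner in the
  second half, so that deleting a pair shortens both halves at once. The conclusion is equality of
  all pairs, since the layers have to agree along the entire walk.\<close>

lemma path_word_lazy_walk:
  assumes "successively path_adj (map fst zs @ map snd zs)"
    and "\<forall>(a, b) \<in> set zs. path_word a = path_word b"
  shows "\<forall>(a, b) \<in> set zs. a = b"
  using assms
proof (induction "length zs" arbitrary: zs rule: less_induct)
  case less
  note walk = less.prems(1) and col = less.prems(2)
  \<comment> \<open>Only the first half is inspected: equality of letters transfers standing still
    and turning back to the second half.\<close>
  consider (stutter) us a b c vs where "zs = us @ [(a, b), (a, c)] @ vs"
    | (backtrack) us a b c d e vs where "zs = us @ [(a, b), (c, d), (a, e)] @ vs"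
    | (straight) "\<And>i. Suc i < length zs \<Longrightarrow> fst (zs ! i) \<noteq> fst (zs ! Suc i)"
        "\<And>i. Suc (Suc i) < length zs \<Longrightarrow> fst (zs ! i) \<noteq> fst (zs ! Suc (Suc i))"
  proof -
    show ?thesis
    proof (cases "\<exists>i. Suc i < length zs \<and> fst (zs ! i) = fst (zs ! Suc i)")
      case True
      then obtain i where i: "Suc i < length zs" "fst (zs ! i) = fst (zs ! Suc i)" by blast
      show ?thesis
      proof (rule that(1))
        have "zs = take i zs @ [zs ! i, zs ! Suc i] @ drop (Suc (Suc i)) zs"
          using i(1) by (simp add: Cons_nth_drop_Suc)
        also have "zs ! Suc i = (fst (zs ! i), snd (zs ! Suc i))"
          using i(2) by (metis prod.collapse)
        also have "[zs ! i, (fst (zs ! i), snd (zs ! Suc i))] =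
            [(fst (zs ! i), snd (zs ! i)), (fst (zs ! i), snd (zs ! Suc i))]" by simp
        finally show "zs = take i zs @ [(fst (zs ! i), snd (zs ! i)), (fst (zs ! i), snd (zs ! Suc i))] @
            drop (Suc (Suc i)) zs" .
      qed
    next
      case no_stutter: False
      show ?thesis
      proof (cases "\<exists>i. Suc (Suc i) < length zs \<and> fst (zs ! i) = fst (zs ! Suc (Suc i))")
        case True
        then obtain i where i: "Suc (Suc i) < length zs" "fst (zs ! i) = fst (zs ! Suc (Suc i))"
          by blast
        have "zs = take i zs @ [zs ! i, zs ! Suc i, zs ! Suc (Suc i)] @ drop (Suc (Suc (Suc i))) zs"
          using i(1) by (simp add: Cons_nth_drop_Suc)
        also have "zs ! Suc (Suc i) = (fst (zs ! i), snd (zs ! Suc (Suc i)))"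
          using i(2) by (metis prod.collapse)
        also have "[zs ! i, zs ! Suc i, (fst (zs ! i), snd (zs ! Suc (Suc i)))] = 
          [(fst (zs ! i), snd (zs ! i)), (fst (zs ! Suc i), snd (zs ! Suc i)),
            (fst (zs ! i), snd (zs ! Suc (Suc i)))]" by simp
        finally show ?thesis by (rule that(2))
      next
        case False
        with no_stutter that(3) show ?thesis by blast
      qed
    qed
  qed
  then show ?case
  proof cases
    case stutter
    \<comment> \<open>The empty middle part gives the walk the shape that
      \<open>successively_contract\<close> expects; the contraction is applied once in each
      half.\<close>
    have walk': "successively path_adj
        (map fst us @ [a] @ [] @ [a] @ map fst vs @ map snd us @ [b, c] @ map snd vs)"
      using walk stutter by simp
    have "path_adj b c"
      using successively_infix[of path_adj "map fst us @ [a, a] @ map fst vs @ map snd us" "[b, c]" "map snd vs"]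
        walk' by simp
    moreover have "path_word b = path_word c"
      using col stutter by auto
    ultimately have "b = c" by (rule path_word_adj_imp_eq[rotated])
    let ?zs = "us @ [(a, b)] @ vs"
    have "successively path_adj ((map fst us @ [a] @ map fst vs @ map snd us) @ [b] @ [] @ [b] @ map snd vs)"
      using successively_contract[OF walk'] \<open>b = c\<close> by simp
    from successively_contract[OF this] have walk'': "successively path_adj (map fst ?zs @ map snd ?zs)"
      by simp
    have len: "length ?zs < length zs" and col': "\<forall>(a, b) \<in> set ?zs. path_word a = path_word b"
      using col stutter by auto
    from less.hyps[OF len walk'' col'] stutter \<open>b = c\<close> show ?thesis by auto
  next
    case backtrack
    have walk': "successively path_adj
        (map fst us @ [a] @ [c] @ [a] @ map fst vs @ map snd us @ [b, d, e] @ map snd vs)"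
      using walk backtrack by simp
    have adj: "path_adj b d" "path_adj d e" "path_adj a c"
      using successively_infix[of path_adj "map fst us @ [a, c, a] @ map fst vs @ map snd us" "[b, d, e]" "map snd vs"]
        successively_infix[of path_adj "map fst us" "[a, c]"
          "[a] @ map fst vs @ map snd us @ [b, d, e] @ map snd vs"] walk' by simp_all
    have cols: "path_word b = path_word e" "path_word c = path_word d"
      using col backtrack by auto
    have "b = e" by (rule path_word_adj_adj_imp_eq[OF cols(1) adj(1,2)])
    let ?zs = "us @ [(a, b)] @ vs"
    have "successively path_adj ((map fst us @ [a] @ map fst vs @ map snd us) @ [b] @ [d] @ [b] @ map snd vs)"
      using successively_contract[OF walk'] \<open>b = e\<close> by simp
    from successively_contract[OF this] have walk'': "successively path_adj (map fst ?zs @ map snd ?zs)"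
      by simp
    have len: "length ?zs < length zs" and col': "\<forall>(a, b) \<in> set ?zs. path_word a = path_word b"
      using col backtrack by auto
    note eq = less.hyps[OF len walk'' col']
    \<comment> \<open>The induction hypothesis gives \<open>a = b\<close>, so \<open>c\<close> and
      \<open>d\<close> are both adjacent to \<open>a\<close> and carry the same letter.\<close>
    then have "c = d"
      using adj cols path_word_adj_adj_imp_eq[of c d a] path_adj_sym \<open>b = e\<close> backtrack by auto
    with eq backtrack \<open>b = e\<close> show ?thesis by auto
  next
    case straight
    define t f g where "t = length zs" and "f i = fst (zs ! i)" and "g i = snd (zs ! i)" for i
    show ?thesis
    proof (cases "t = 0")
      case False
      have col': "path_word (f i) = path_word (g i)" if "i < t" for i
        using bspec[OF col nth_mem[of i zs]] that by (simp add: f_def g_def t_def case_prod_beta)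
      have parts: "successively path_adj (map fst zs)" "successively path_adj (map snd zs)"
          "path_adj (last (map fst zs)) (hd (map snd zs))"
        using walk False by (simp_all add: successively_append_iff t_def)
      have adj_f: "path_adj (f i) (f (Suc i))" if "Suc i < t" for i
        using successively_nth[OF parts(1), of i] that by (simp add: f_def t_def)
      have adj_g: "path_adj (g i) (g (Suc i))" if "Suc i < t" for i
        using successively_nth[OF parts(2), of i] that by (simp add: g_def t_def)
      have join: "path_adj (f (t - 1)) (g 0)"
        using parts(3) False by (simp add: f_def g_def t_def last_conv_nth hd_conv_nth)
      have f_neq: "f i \<noteq> f (Suc i)" if "Suc i < t" for i
        using straight(1) that by (simp add: f_def t_def)
      have f_neq': "f i \<noteq> f (Suc (Suc i))" if "Suc (Suc i) < t" for i
        using straight(2) that by (simp add: f_def t_def)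
      \<comment> \<open>If the second half stood still or turned back, the letters of the first half
        would repeat at distance at most two, and so would its positions.\<close>
      have g_neq: "g i \<noteq> g (Suc i)" if "Suc i < t" for i
        using f_neq[OF that] adj_f[OF that] col'[of i] col'[of "Suc i"] that path_word_adj_imp_eq
        by (metis Suc_lessD)
      have g_neq': "g i \<noteq> g (Suc (Suc i))" if "Suc (Suc i) < t" for i
        using f_neq'[OF that] adj_f[of i] adj_f[of "Suc i"] col'[of i] col'[of "Suc (Suc i)"] that
          path_word_adj_adj_imp_eq by (metis Suc_lessD)
      obtain a where fdir: "(\<forall>i<t. f i = a + i) \<or> (\<forall>i<t. f i + i = a)"
        using straight_walk[of t f, OF adj_f f_neq f_neq'] by blast
      obtain c where gdir: "(\<forall>i<t. g i = c + i) \<or> (\<forall>i<t. g i + i = c)"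
        using straight_walk[of t g, OF adj_g g_neq g_neq'] by blast
      have ends: "t - 1 < t" "0 < t" using False by simp_all
      have "f i = g i" if "i < t" for i
      \<comment> \<open>For \<open>t = 1\<close> no direction is determined, but the single pair is
        adjacent through the junction of the two halves.\<close>
      proof (cases "t = 1")
        case True
        then show ?thesis
          using that col'[of 0] join path_word_adj_imp_eq[of "f 0" "g 0"] by simp
      next
        case t: False
        from fdir gdir consider (uu) "\<forall>i<t. f i = a + i" "\<forall>i<t. g i = c + i"
          | (ud) "\<forall>i<t. f i = a + i" "\<forall>i<t. g i + i = c"
          | (du) "\<forall>i<t. f i + i = a" "\<forall>i<t. g i = c + i"
          | (dd) "\<forall>i<t. f i + i = a" "\<forall>i<t. g i + i = c" by blast
        then show ?thesis
        proof cases
          case uu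
          from uu(1)[rule_format, OF ends(1)] uu(2)[rule_format, OF ends(2)]
          have "a + t \<le> c + 2" "c \<le> a + t" using join False by (auto simp: path_adj_def)
          moreover have "path_word (a + i) = path_word (c + i)" if "i < t" for i
            using col'[OF that] uu that by simp
          ultimately have "a = c" using path_word_parallel_up[of t a c] False by simp
          with uu that show ?thesis by simp
        next
          case ud
          from ud(1)[rule_format, OF ends(1)] ud(2)[rule_format, OF ends(2)]
          have "a + t \<le> c + 2" "c \<le> a + t" using join False by (auto simp: path_adj_def)
          then show ?thesis
            using path_word_antiparallel[of t f a g c] ud False t col' by force
        next
          case du
          from du(1)[rule_format, OF ends(1)] du(2)[rule_format, OF ends(2)]
          have "c + t \<le> a + 2" "a \<le> c + t" using join False by (auto simp: path_adj_def)
          then show ?thesis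
            using path_word_antiparallel[of t g c f a] du False t col' by force
        next
          case dd
          from dd(1)[rule_format, OF ends(1)] dd(2)[rule_format, OF ends(2)]
          have "c + t \<le> a + 2" "a \<le> c + t" using join False by (auto simp: path_adj_def)
          then have "a = c"
            using dd False col' by (intro path_word_parallel_down[of t f a g c]) auto
          with dd that show ?thesis by (metis add_right_cancel)
        qed
      qed
      then have eq: "fst (zs ! i) = snd (zs ! i)" if "i < length zs" for i
        using that by (simp add: f_def g_def t_def)
      show ?thesis
      proof clarify
        fix x y assume "(x, y) \<in> set zs"
        then obtain i where "i < length zs" "zs ! i = (x, y)" by (meson in_set_conv_nth)
        with eq[of i] show "x = y" by simp
      qed
    qed (simp add: t_def)
  qed
qed

section \<open>Elimination orders from tree decompositions\<close>

definition earlier :: "'a set \<Rightarrow> ('a \<Rightarrow> 'a \<Rightarrow> bool) \<Rightarrow> ('a \<Rightarrow> nat) \<Rightarrow> 'a \<Rightarrow> 'a set" where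
  "earlier V R pos v = {u \<in> V. R u v \<and> pos u < pos v}"

text \<open>The clique condition includes the case \<open>u = u'\<close>; this fits relations such
  as \<open>share_bag\<close>, which is reflexive on the vertices occurring in bags.\<close>

definition elimination_order :: "'a set \<Rightarrow> ('a \<Rightarrow> 'a \<Rightarrow> bool) \<Rightarrow> ('a \<Rightarrow> nat) \<Rightarrow> nat \<Rightarrow> bool" where
  "elimination_order V R pos k \<longleftrightarrow> inj_on pos V \<and>
    (\<forall>v\<in>V. card (earlier V R pos v) \<le> k \<and>
      (\<forall>u\<in>earlier V R pos v. \<forall>u'\<in>earlier V R pos v. R u u'))"

definition share_bag :: "'b set \<Rightarrow> ('b \<Rightarrow> 'a set) \<Rightarrow> 'a \<Rightarrow> 'a \<Rightarrow> bool" where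
  "share_bag T B u v \<longleftrightarrow> (\<exists>x\<in>T. u \<in> B x \<and> v \<in> B x)"

text \<open>The first vertex \<open>x\<close> of a longest path has all its neighbours on that path,
  and a neighbour beyond the second vertex \<open>y\<close> would close a cycle.\<close>

lemma forest_leaf:
  assumes "finite T" "T \<noteq> {}" "\<And>u v. TE u v \<Longrightarrow> TE v u" "\<nexists>c. is_cycle T TE c"
  obtains x y where "x \<in> T" "\<And>z. z \<in> T \<Longrightarrow> TE x z \<Longrightarrow> z = x \<or> z = y"
proof -
  let ?P = "\<lambda>c. distinct c \<and> set c \<subseteq> T \<and> c \<noteq> [] \<and> successively TE c"
  have "\<exists>c. ?P c"
    using assms(2) by (auto intro!: exI[of _ "[SOME x. x \<in> T]"] some_in_eq[THEN iffD2])
  moreover have "\<forall>c. ?P c \<longrightarrow> length c < Suc (card T)"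
    using assms(1) by (metis card_mono distinct_card le_imp_less_Suc)
  ultimately obtain c where c: "?P c" and max: "\<And>d. ?P d \<Longrightarrow> length d \<le> length c"
    using ex_has_greatest_nat[of ?P _ length] by blast
  then obtain x c' where x: "c = x # c'" by (cases c) auto
  have in_c: "z \<in> set c" if "z \<in> T" "TE x z" for z
  proof (rule ccontr)
    assume "z \<notin> set c"
    with c that x assms(3) have "?P (z # c)" by (auto simp: successively_Cons)
    with max[of "z # c"] show False by simp
  qed
  show thesis
  proof (cases c')
    case Nil
    \<comment> \<open>The longest path is a single vertex, so \<open>x\<close> has no neighbour
      other than possibly itself and any \<open>y\<close> will do.\<close>
    with in_c x c that[of x x] show thesis by auto
  next
    case y: (Cons y c'')
    have "z = x \<or> z = y" if z: "z \<in> T" "TE x z" for z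
    proof (rule ccontr)
      assume "\<not> ?thesis"
      with in_c[OF z] x y obtain us vs where c'': "c'' = us @ z # vs"
        by (auto simp: in_set_conv_decomp)
      let ?c = "x # y # us @ [z]"
      have "successively TE ?c"
        using successively_infix[of TE "[]" ?c vs] c x y c'' by simp
      then have "is_cycle T TE ?c"
        using c x y c'' assms(3)[OF z(2)] unfolding is_cycle_def successively_conv_nth by auto
      with assms(4) show False by blast
    qed
    with c x that show thesis by auto
  qed
qed

lemma connected_on_remove_leaf:
  assumes "connected_on S TE" "\<And>u v. TE u v \<Longrightarrow> TE v u"
    and leaf: "\<And>z. z \<in> S \<Longrightarrow> TE x z \<Longrightarrow> z = x \<or> z = y"
  shows "connected_on (S - {x}) TE"
  unfolding connected_on_def
proof (intro ballI)
  fix a b assume a: "a \<in> S - {x}" and b: "b \<in> S - {x}"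
  let ?R = "\<lambda>a b. a \<in> S - {x} \<and> b \<in> S - {x} \<and> TE a b"
  have "(\<lambda>a b. a \<in> S \<and> b \<in> S \<and> TE a b)\<^sup>*\<^sup>* a b"
    using assms(1) a b by (auto simp: connected_on_def)
  \<comment> \<open>Excursions to the leaf leave from \<open>y\<close> and come back to \<open>y\<close>.\<close>
  then have "?R\<^sup>*\<^sup>* a (if b = x then y else b)"
  proof (induction)
    case base
    with a show ?case by auto
  next
    case (step b c)
    then have "TE b c" "TE c b" "b \<in> S" "c \<in> S" using assms(2) by auto
    with leaf step.IH show ?case
      by (cases "b = x"; cases "c = x") (auto intro: rtranclp.rtrancl_into_rtrancl)
  qed
  with b show "?R\<^sup>*\<^sup>* a b" by auto
qed

text \<open>Remove a leaf node \<open>x\<close> and put the vertices that occur only in its bag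
  last: all their earlier neighbours lie in that bag. The formulation for forests means that only
  acyclicity has to be inherited by the remaining nodes.\<close>

lemma forest_elimination_order:
  fixes B :: "'b \<Rightarrow> 'a set"
  assumes "finite T" "\<And>u v. TE u v \<Longrightarrow> TE v u" "\<nexists>c. is_cycle T TE c"
    and "\<And>x. x \<in> T \<Longrightarrow> finite (B x) \<and> card (B x) \<le> Suc k"
    and "\<And>v. connected_on {x \<in> T. v \<in> B x} TE"
  shows "\<exists>pos. elimination_order (\<Union>(B ` T)) (share_bag T B) pos k"
  using assms
proof (induction T rule: finite_psubset_induct)
  case (psubset T)
  show ?case
  proof (cases "T = {}")
    case True
    then show ?thesis by (simp add: elimination_order_def)
  next
    case False
    from psubset.hyps False psubset.prems(1,2) obtain x y
      where x: "x \<in> T" and leaf: "\<And>z. z \<in> T \<Longrightarrow> TE x z \<Longrightarrow> z = x \<or> z = y"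
      by (rule forest_leaf) blast+
    define T' where "T' = T - {x}"
    have T: "T = insert x T'" "x \<notin> T'" using x by (auto simp: T'_def)
    define V' where "V' = \<Union>(B ` T')"
    define X where "X = B x - V'"
    have "T' \<subset> T" using T by auto
    moreover have "\<nexists>c. is_cycle T' TE c"
      using psubset.prems(2) T by (force simp: is_cycle_def)
    moreover have "connected_on {x \<in> T'. v \<in> B x} TE" for v
    proof -
      have "{x \<in> T'. v \<in> B x} = {x \<in> T. v \<in> B x} - {x}" using T by auto
      with connected_on_remove_leaf[OF psubset.prems(4)[of v] psubset.prems(1), where x=x and y=y] leaf
      show ?thesis by auto
    qed
    ultimately obtain pos where pos: "elimination_order V' (share_bag T' B) pos k"
      using psubset.IH[of T'] psubset.prems(1,3) unfolding V'_def by blast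
    have "finite V'" "finite X"
      using psubset.hyps psubset.prems(3) T by (auto simp: V'_def X_def)
    then obtain M where M: "\<And>v. v \<in> V' \<Longrightarrow> pos v < M"
      using finite_nat_set_iff_bounded[of "pos ` V'"] by auto
    obtain f :: "'a \<Rightarrow> nat" where f: "inj_on f X"
      using finite_imp_inj_to_nat_seg[OF \<open>finite X\<close>] by blast
    \<comment> \<open>Old vertices keep their positions, all below \<open>M\<close>; the new ones
      follow in an arbitrary injective order.\<close>
    define pos' where "pos' v = (if v \<in> X then M + f v else pos v)" for v
    have V: "\<Union>(B ` T) = V' \<union> X" "V' \<inter> X = {}" using T by (auto simp: V'_def X_def)
    \<comment> \<open>A vertex of the leaf bag that also occurs elsewhere must occur in the bag of
      \<open>y\<close>, because the nodes containing it are connected and \<open>x\<close> can only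
      be left through \<open>y\<close>. Hence deleting the leaf separates no two old vertices that
      share a bag.\<close>
    have in_y: "y \<in> T' \<and> v \<in> B y" if v: "v \<in> B x" "v \<in> V'" for v
    proof -
      let ?R = "\<lambda>a b. a \<in> {x \<in> T. v \<in> B x} \<and> b \<in> {x \<in> T. v \<in> B x} \<and> TE a b"
      from v obtain t where t: "t \<in> T'" "v \<in> B t" by (auto simp: V'_def)
      with v T psubset.prems(4)[of v] have "?R\<^sup>*\<^sup>* x t" by (auto simp: connected_on_def)
      then have "t = x \<or> (y \<in> T \<and> v \<in> B y \<and> y \<noteq> x)"
        by (induction rule: rtranclp_induct) (use leaf in auto)
      with t(1) T show ?thesis by auto
    qed
    have share_old: "share_bag T B u v \<longleftrightarrow> share_bag T' B u v" if "u \<in> V'" "v \<in> V'" for u v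
    proof -
      have "share_bag T B u v \<longleftrightarrow> (u \<in> B x \<and> v \<in> B x) \<or> share_bag T' B u v"
        unfolding T(1) share_bag_def by blast
      moreover have "share_bag T' B u v" if "u \<in> B x" "v \<in> B x"
        using in_y[OF that(1) \<open>u \<in> V'\<close>] in_y[OF that(2) \<open>v \<in> V'\<close>] unfolding share_bag_def by blast
      ultimately show ?thesis by blast
    qed
    have old: "pos' v = pos v" if "v \<in> V'" for v
      using that V(2) by (auto simp: pos'_def)
    have new: "pos' v = M + f v" if "v \<in> X" for v
      using that by (simp add: pos'_def)
    have "inj_on pos' V'"
      using pos by (simp add: elimination_order_def old cong: inj_on_cong)
    moreover have "inj_on pos' X"
      using f by (simp add: inj_on_def new)
    moreover have "pos' u \<noteq> pos' v" if "u \<in> V'" "v \<in> X" for u v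
      using M[OF that(1)] old[OF that(1)] new[OF that(2)] by simp
    ultimately have "inj_on pos' (V' \<union> X)"
      by (fastforce simp: inj_on_Un)
    moreover have "card (earlier (V' \<union> X) (share_bag T B) pos' v) \<le> k \<and>
        (\<forall>u\<in>earlier (V' \<union> X) (share_bag T B) pos' v. \<forall>u'\<in>earlier (V' \<union> X) (share_bag T B) pos' v.
          share_bag T B u u')" if v: "v \<in> V' \<union> X" for v
    proof (cases "v \<in> X")
      case True
      then have "v \<in> B x" "v \<notin> V'" by (auto simp: X_def)
      then have sub: "earlier (V' \<union> X) (share_bag T B) pos' v \<subseteq> B x - {v}"
        using T by (auto simp: earlier_def share_bag_def V'_def)
      have "card (B x - {v}) \<le> k" "finite (B x - {v})"
        using psubset.prems(3)[OF x] \<open>v \<in> B x\<close> by auto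
      with sub have "card (earlier (V' \<union> X) (share_bag T B) pos' v) \<le> k"
        by (meson card_mono le_trans)
      with sub x show ?thesis by (fastforce simp: share_bag_def)
    next
      case False
      with v have v': "v \<in> V'" by simp
      have "\<not> pos' u < pos' v" if "u \<in> X" for u
        using M[OF v'] old[OF v'] new[OF that] by simp
      then have "earlier (V' \<union> X) (share_bag T B) pos' v = earlier V' (share_bag T' B) pos v"
        using v' by (auto simp: earlier_def old share_old)
      moreover have "earlier V' (share_bag T' B) pos v \<subseteq> V'" by (auto simp: earlier_def)
      ultimately show ?thesis
        using pos v' share_old by (auto simp: elimination_order_def subset_iff)
    qed
    ultimately show ?thesis
      unfolding elimination_order_def V(1) by blast
  qed
qed

section \<open>Layers of an elimination order\<close>

definition layer :: "'a set \<Rightarrow> ('a \<Rightarrow> 'a \<Rightarrow> bool) \<Rightarrow> ('a \<Rightarrow> nat) \<Rightarrow> 'a \<Rightarrow> nat" where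
  "layer V R pos = wfrec (measure pos)
    (\<lambda>l v. if earlier V R pos v = {} then 0 else Suc (Min (l ` earlier V R pos v)))"

lemma layer_unfold:
  "layer V R pos v =
    (if earlier V R pos v = {} then 0 else Suc (Min (layer V R pos ` earlier V R pos v)))"
proof -
  \<comment> \<open>Earlier neighbours have smaller positions, so the truncation built into
    \<open>wfrec\<close> does not affect them.\<close>
  have "cut (layer V R pos) (measure pos) v ` earlier V R pos v = layer V R pos ` earlier V R pos v"
    by (rule image_cong) (auto simp: earlier_def cut_apply)
  then show ?thesis
    by (subst def_wfrec[OF layer_def[THEN eq_reflection] wf_measure]) simp
qed

section \<open>Layers of adjacent vertices\<close>

lemma earlier_cases:
  assumes "elimination_order V R pos k" "\<And>u v. R u v \<Longrightarrow> R v u" "R u v" "u \<in> V" "v \<in> V"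
  shows "u = v \<or> u \<in> earlier V R pos v \<or> v \<in> earlier V R pos u"
proof -
  have "pos u < pos v \<or> pos v < pos u \<or> u = v"
    using assms(1,4,5) by (metis elimination_order_def inj_onD linorder_neqE_nat)
  then show ?thesis
    using assms(2)[OF assms(3)] assms(3-5) by (auto simp: earlier_def)
qed

lemma layer_le_Suc_earlier:
  assumes "finite V" "u \<in> earlier V R pos v"
  shows "layer V R pos v \<le> Suc (layer V R pos u)"
proof -
  have "finite (earlier V R pos v)" using assms(1) by (simp add: earlier_def)
  with assms(2) show ?thesis by (subst layer_unfold) (auto intro: Min_le)
qed

lemma layer_eq_Suc_earlier:
  assumes "finite V" "earlier V R pos v \<noteq> {}"
  obtains u where "u \<in> earlier V R pos v" "layer V R pos v = Suc (layer V R pos u)"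
proof -
  have "finite (earlier V R pos v)" using assms(1) by (simp add: earlier_def)
  with assms(2) have "Min (layer V R pos ` earlier V R pos v) \<in> layer V R pos ` earlier V R pos v"
    by (intro Min_in) auto
  with assms(2) that layer_unfold[of V R pos v] show thesis by auto
qed

text \<open>Let \<open>w\<close> be a lowest earlier neighbour of \<open>v\<close>. By the clique
  condition \<open>u\<close> is related to \<open>w\<close>. If \<open>u\<close> comes before
  \<open>w\<close>, induction puts it no higher than \<open>w\<close>; if after, at most one layer
  above \<open>w\<close>, which is the layer of \<open>v\<close>.\<close>

lemma layer_earlier_le:
  assumes "finite V" "elimination_order V R pos k" "\<And>u v. R u v \<Longrightarrow> R v u"
    and "v \<in> V" "u \<in> earlier V R pos v"
  shows "layer V R pos u \<le> layer V R pos v"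
  using assms(4,5)
proof (induction "pos v" arbitrary: u v rule: less_induct)
  case less
  then obtain w where w: "w \<in> earlier V R pos v" "layer V R pos v = Suc (layer V R pos w)"
    using layer_eq_Suc_earlier[OF assms(1)] by blast
  with less.prems assms(2) have "R u w" "u \<in> V" "w \<in> V" "pos w < pos v"
    by (auto simp: elimination_order_def earlier_def)
  then have "u = w \<or> u \<in> earlier V R pos w \<or> w \<in> earlier V R pos u"
    using earlier_cases[OF assms(2,3)] by blast
  then show ?case
    using less.hyps[OF \<open>pos w < pos v\<close> \<open>w \<in> V\<close>] layer_le_Suc_earlier[OF assms(1)] w(2) by fastforce
qed

lemma layer_path_adj:
  assumes "finite V" "elimination_order V R pos k" "\<And>u v. R u v \<Longrightarrow> R v u" "R u v \<or> u = v"
    and "u \<in> V" "v \<in> V"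
  shows "path_adj (layer V R pos u) (layer V R pos v)"
proof -
  have "path_adj (layer V R pos u) (layer V R pos v)"
    if "u \<in> earlier V R pos v" "v \<in> V" for u v
    using layer_earlier_le[OF assms(1-3) that(2,1)] layer_le_Suc_earlier[OF assms(1) that(1)]
    by (auto simp: path_adj_def)
  with earlier_cases[OF assms(2,3)] assms(4-6) path_adj_sym show ?thesis
    by (metis path_adj_def)
qed

text \<open>The disjunction makes the induction work: its second alternative describes a walk that
  has stepped from the retained vertex \<open>u\<close> into a run of copies of
  \<open>v\<close>.\<close>

lemma successively_filter_Cons:
  assumes "u \<noteq> v" "successively R (u # ws) \<or> R u v \<and> successively R (v # ws)" "u \<in> S" "set ws \<subseteq> S"
    and "\<And>x y. x \<in> S \<Longrightarrow> y \<in> S \<Longrightarrow> x \<noteq> v \<Longrightarrow> y \<noteq> v \<Longrightarrow> R x v \<Longrightarrow> R v y \<Longrightarrow> R x y"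
  shows "successively R (u # filter (\<lambda>x. x \<noteq> v) ws)"
  using assms(1-4)
proof (induction ws arbitrary: u)
  case (Cons w ws)
  show ?case
  proof (cases "w = v")
    case True
    with Cons show ?thesis by auto
  next
    case False
    with Cons.prems assms(5)[of u w] have "R u w" "successively R (w # ws)" by auto
    with False Cons.IH[of w] Cons.prems show ?thesis by auto
  qed
qed simp

lemma successively_filter_neq:
  assumes "successively R ws"
    and "\<And>x y. x \<in> set ws \<Longrightarrow> y \<in> set ws \<Longrightarrow> x \<noteq> v \<Longrightarrow> y \<noteq> v \<Longrightarrow> R x v \<Longrightarrow> R v y \<Longrightarrow> R x y"
  shows "successively R (filter (\<lambda>x. x \<noteq> v) ws)"
  using assms
proof (induction ws)
  case (Cons w ws)
  show ?case
  proof (cases "w = v")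
    case True
    have "successively R ws" using Cons.prems(1) by (auto simp: successively_Cons)
    with True Cons.IH Cons.prems(2) show ?thesis by auto
  next
    case False
    with successively_filter_Cons[of w v R ws "set (w # ws)"] Cons.prems show ?thesis by auto
  qed
qed simp

lemma successively_filter_layer:
  assumes "finite V" "elimination_order V R pos k" "\<And>u v. R u v \<Longrightarrow> R v u"
    and "successively (\<lambda>x y. R x y \<or> x = y) ws" "set ws \<subseteq> V" "\<forall>x\<in>set ws. d \<le> layer V R pos x"
  shows "successively (\<lambda>x y. R x y \<or> x = y) (filter (\<lambda>x. layer V R pos x = d) ws)"
  using assms(4-6)
proof (induction "card {x \<in> set ws. layer V R pos x \<noteq> d}" arbitrary: ws rule: less_induct)
  case less
  let ?A = "{x \<in> set ws. layer V R pos x \<noteq> d}"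
  show ?case
  proof (cases "?A = {}")
    case True
    then have "filter (\<lambda>x. layer V R pos x = d) ws = ws" by (auto simp: filter_id_conv)
    with less.prems show ?thesis by simp
  next
    case False
    obtain v where v: "v \<in> ?A" and max: "\<And>x. x \<in> ?A \<Longrightarrow> pos x \<le> pos v"
    proof -
      have "Max (pos ` ?A) \<in> pos ` ?A" using False by (intro Max_in) auto
      then obtain v where v: "Max (pos ` ?A) = pos v" "v \<in> ?A" by (rule imageE)
      show thesis
        by (rule that[OF v(2)], fold v(1), rule Max_ge) auto
    qed
    \<comment> \<open>The last vertex above layer \<open>d\<close> has only earlier neighbours on the walk, and these form a
      clique, so the walk can skip it.\<close>
    have earlier: "x \<in> earlier V R pos v" if x: "x \<in> set ws" "x \<noteq> v" "R x v" for x
    proof (rule ccontr)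
      assume neg: "x \<notin> earlier V R pos v"
      have V: "x \<in> V" "v \<in> V" using x v less.prems(2) by auto
      with neg x have *: "v \<in> earlier V R pos x"
        using earlier_cases[OF assms(2,3) x(3)] by blast
      \<comment> \<open>A neighbour after \<open>v\<close> would be at least as high as
        \<open>v\<close>, hence itself above layer \<open>d\<close>, against the choice of
        \<open>v\<close> as the last such vertex.\<close>
      then have "layer V R pos v \<le> layer V R pos x"
        using layer_earlier_le[OF assms(1-3)] V by blast
      with v x(1) less.prems(3) have "x \<in> ?A" by force
      with max[of x] * show False by (simp add: earlier_def)
    qed
    let ?ws = "filter (\<lambda>x. x \<noteq> v) ws"
    have "successively (\<lambda>x y. R x y \<or> x = y) ?ws"
    proof (rule successively_filter_neq[OF less.prems(1)])
      fix x y assume xy: "x \<in> set ws" "y \<in> set ws" "x \<noteq> v" "y \<noteq> v" "R x v \<or> x = v" "R v y \<or> v = y"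
      then have "x \<in> earlier V R pos v" "y \<in> earlier V R pos v"
        using earlier assms(3) by auto
      with assms(2) v less.prems(2) show "R x y \<or> x = y"
        by (auto simp: elimination_order_def)
    qed
    moreover have "card {x \<in> set ?ws. layer V R pos x \<noteq> d} < card ?A"
      using v by (intro psubset_card_mono) auto
    ultimately have "successively (\<lambda>x y. R x y \<or> x = y) (filter (\<lambda>x. layer V R pos x = d) ?ws)"
      using less.prems by (intro less.hyps) auto
    moreover have "filter (\<lambda>x. layer V R pos x = d) ?ws = filter (\<lambda>x. layer V R pos x = d) ws"
      using v by (auto simp: intro!: filter_cong)
    ultimately show ?thesis by simp
  qed
qed

section \<open>Colouring along an elimination order\<close>

text \<open>Translates index arithmetic into a list of pairs of corresponding vertices, so that
  filtering this list acts on both halves simultaneously.\<close>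

lemma repetitive_lazy_walk_iff:
  "lazy_walk V E ws \<and> repetitive \<phi> ws \<longleftrightarrow>
    (\<exists>zs. zs \<noteq> [] \<and> ws = map fst zs @ map snd zs \<and> set ws \<subseteq> V \<and>
      successively (\<lambda>x y. E x y \<or> x = y) ws \<and> (\<forall>(a, b) \<in> set zs. \<phi> a = \<phi> b))"
proof -
  have "repetitive \<phi> ws \<longleftrightarrow>
    (\<exists>zs. zs \<noteq> [] \<and> ws = map fst zs @ map snd zs \<and> (\<forall>(a, b) \<in> set zs. \<phi> a = \<phi> b))"
  proof
    assume "repetitive \<phi> ws"
    then obtain t where t: "t \<ge> 1" "length ws = 2 * t" "\<And>i. i < t \<Longrightarrow> \<phi> (ws ! i) = \<phi> (ws ! (i + t))"
      by (auto simp: repetitive_def)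
    let ?zs = "zip (take t ws) (drop t ws)"
    have "?zs \<noteq> []" "ws = map fst ?zs @ map snd ?zs" using t by auto
    moreover have "\<forall>(a, b) \<in> set ?zs. \<phi> a = \<phi> b"
      using t by (auto simp: set_zip add.commute)
    ultimately show "\<exists>zs. zs \<noteq> [] \<and> ws = map fst zs @ map snd zs \<and> (\<forall>(a, b) \<in> set zs. \<phi> a = \<phi> b)"
      by blast
  next
    assume "\<exists>zs. zs \<noteq> [] \<and> ws = map fst zs @ map snd zs \<and> (\<forall>(a, b) \<in> set zs. \<phi> a = \<phi> b)"
    then obtain zs where zs: "zs \<noteq> []" "ws = map fst zs @ map snd zs" "\<forall>(a, b) \<in> set zs. \<phi> a = \<phi> b"
      by blast
    have "\<phi> (fst (zs ! i)) = \<phi> (snd (zs ! i))" if "i < length zs" for i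
      using bspec[OF zs(3) nth_mem[OF that]] by (simp add: case_prod_beta)
    with zs(1,2) show "repetitive \<phi> ws"
      unfolding repetitive_def by (intro exI[of _ "length zs"]) (auto simp: nth_append Suc_le_eq)
  qed
  then show ?thesis
    by (auto simp: lazy_walk_def successively_conv_nth)
qed

lemma strongly_nonrepetitiveI:
  assumes "\<And>zs. \<lbrakk>zs \<noteq> []; set (map fst zs @ map snd zs) \<subseteq> V;
      successively (\<lambda>x y. E x y \<or> x = y) (map fst zs @ map snd zs);
      \<forall>(a, b) \<in> set zs. \<phi> a = \<phi> b\<rbrakk> \<Longrightarrow> \<exists>(a, b) \<in> set zs. a = b"
  shows "strongly_nonrepetitive V E \<phi>"
  unfolding strongly_nonrepetitive_def repetitive_lazy_walk_iff
proof (intro allI impI, elim exE conjE)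
  fix ws zs
  assume "zs \<noteq> []" and ws: "ws = map fst zs @ map snd zs" and "set ws \<subseteq> V"
    "successively (\<lambda>x y. E x y \<or> x = y) ws" "\<forall>(a, b) \<in> set zs. \<phi> a = \<phi> b"
  with assms[of zs] have "\<exists>(a, b) \<in> set zs. a = b" by simp
  then obtain i where "i < length zs" "fst (zs ! i) = snd (zs ! i)"
    by (metis (mono_tags, lifting) case_prod_beta in_set_conv_nth)
  with ws show "let t = length ws div 2 in \<exists>i<t. ws ! i = ws ! (i + t)"
    by (auto simp: nth_append Let_def)
qed

lemma strongly_nonrepetitiveD:
  assumes "strongly_nonrepetitive V E \<phi>" "zs \<noteq> []" "set (map fst zs @ map snd zs) \<subseteq> V"
    "successively (\<lambda>x y. E x y \<or> x = y) (map fst zs @ map snd zs)" "\<forall>(a, b) \<in> set zs. \<phi> a = \<phi> b"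
  shows "\<exists>(a, b) \<in> set zs. a = b"
proof -
  let ?ws = "map fst zs @ map snd zs"
  have "lazy_walk V E ?ws \<and> repetitive \<phi> ?ws"
    using assms(2-5) unfolding repetitive_lazy_walk_iff by blast
  with assms(1) have "let t = length ?ws div 2 in \<exists>i<t. ?ws ! i = ?ws ! (i + t)"
    unfolding strongly_nonrepetitive_def by blast
  then obtain i where "i < length zs" "fst (zs ! i) = snd (zs ! i)"
    by (auto simp: nth_append Let_def)
  then show ?thesis
    by (intro bexI[of _ "zs ! i"]) (auto simp: case_prod_beta)
qed

section \<open>The induction over layers\<close>

lemma successively_eq_imp_eq: "successively (=) xs \<Longrightarrow> x \<in> set xs \<Longrightarrow> x = hd xs"
  by (induction xs rule: induct_list012) auto

text \<open>The lowest earlier neighbour of \<open>v\<close> lies one layer below \<open>v\<close>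
  and is lost when the relation is restricted to layers, so the bound drops by one under the same
  order.\<close>

lemma elimination_order_layer:
  assumes "finite V" "elimination_order V R pos (Suc k)"
  shows "elimination_order V (\<lambda>u v. R u v \<and> layer V R pos u = layer V R pos v) pos k"
    (is "elimination_order V ?R pos k")
proof -
  have sub: "earlier V ?R pos v \<subseteq> earlier V R pos v" for v
    by (auto simp: earlier_def)
  have "card (earlier V ?R pos v) \<le> k" if "v \<in> V" for v
  proof (cases "earlier V R pos v = {}")
    case True
    with sub[of v] show ?thesis by simp
  next
    case False
    then obtain u where u: "u \<in> earlier V R pos v" "layer V R pos v = Suc (layer V R pos u)"
      using layer_eq_Suc_earlier[OF assms(1)] by blast
    then have "u \<notin> earlier V ?R pos v" by (simp add: earlier_def)
    with u(1) sub[of v] have "earlier V ?R pos v \<subset> earlier V R pos v" by blast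
    moreover have "finite (earlier V R pos v)" using assms(1) by (simp add: earlier_def)
    ultimately have "card (earlier V ?R pos v) < card (earlier V R pos v)"
      by (rule psubset_card_mono[rotated])
    with assms(2) that show ?thesis by (fastforce simp: elimination_order_def)
  qed
  moreover have "R u u' \<and> layer V R pos u = layer V R pos u'"
    if "v \<in> V" "u \<in> earlier V ?R pos v" "u' \<in> earlier V ?R pos v" for u u' v
  proof
    show "R u u'" using assms(2) that sub[of v] unfolding elimination_order_def by blast
    show "layer V R pos u = layer V R pos u'" using that(2,3) by (simp add: earlier_def)
  qed
  ultimately show ?thesis
    using assms(2) unfolding elimination_order_def by blast
qed

lemma strongly_nonrepetitive_layers:
  assumes "finite V" "elimination_order V R pos k" "\<And>u v. R u v \<Longrightarrow> R v u"
    and \<phi>: "strongly_nonrepetitive V (\<lambda>u v. R u v \<and> layer V R pos u = layer V R pos v) \<phi>"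
    and \<psi>: "\<And>u v. \<psi> u = \<psi> v \<Longrightarrow> \<phi> u = \<phi> v \<and> path_word (layer V R pos u) = path_word (layer V R pos v)"
  shows "strongly_nonrepetitive V R \<psi>"
proof (rule strongly_nonrepetitiveI)
  fix zs
  assume "zs \<noteq> []" and V: "set (map fst zs @ map snd zs) \<subseteq> V"
    and walk: "successively (\<lambda>x y. R x y \<or> x = y) (map fst zs @ map snd zs)"
    and col: "\<forall>(a, b) \<in> set zs. \<psi> a = \<psi> b"
  let ?l = "layer V R pos"
  have "successively path_adj (map ?l (map fst zs @ map snd zs))"
    unfolding successively_map
    by (rule successively_mono[OF walk]) (use layer_path_adj[OF assms(1-3)] V in blast)
  then have "successively path_adj (map fst (map (map_prod ?l ?l) zs) @ map snd (map (map_prod ?l ?l) zs))"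
    by (simp add: comp_def)
  moreover have "\<forall>(a, b) \<in> set (map (map_prod ?l ?l) zs). path_word a = path_word b"
    using col \<psi> unfolding set_map by blast
  ultimately have "\<forall>(a, b) \<in> set (map (map_prod ?l ?l) zs). a = b"
    by (rule path_word_lazy_walk)
  then have eq: "?l (fst z) = ?l (snd z)" if "z \<in> set zs" for z
    using that by (auto simp: case_prod_beta)
  \<comment> \<open>The minimum over the first half suffices, since corresponding vertices have
    equal layers.\<close>
  define d where "d = Min (?l ` fst ` set zs)"
  have "d \<in> ?l ` fst ` set zs"
    unfolding d_def using \<open>zs \<noteq> []\<close> by (intro Min_in) auto
  have "d \<le> ?l (fst z)" if "z \<in> set zs" for z
    unfolding d_def using that by (intro Min_le) auto
  moreover from this eq have "d \<le> ?l (snd z)" if "z \<in> set zs" for z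
    using that by metis
  ultimately have "\<forall>x \<in> set (map fst zs @ map snd zs). d \<le> ?l x" by auto
  from successively_filter_layer[OF assms(1-3) walk V this]
  have filtered: "successively (\<lambda>x y. R x y \<or> x = y)
      (filter (\<lambda>x. ?l x = d) (map fst zs @ map snd zs))" .
  define ys where "ys = filter (\<lambda>z. ?l (fst z) = d) zs"
  \<comment> \<open>Equal layers of partners mean that the same positions survive in both halves, so
    the filtered walk is again repetitive.\<close>
  have "filter (\<lambda>z. ?l (snd z) = d) zs = ys"
    unfolding ys_def by (rule filter_cong) (use eq in auto)
  then have ys: "filter (\<lambda>x. ?l x = d) (map fst zs @ map snd zs) = map fst ys @ map snd ys"
    by (simp add: filter_map comp_def ys_def)
  have "ys \<noteq> []"
    using \<open>d \<in> ?l ` fst ` set zs\<close> by (auto simp: ys_def filter_empty_conv)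
  moreover have sub: "set ys \<subseteq> set zs" by (auto simp: ys_def)
  with V have "set (map fst ys @ map snd ys) \<subseteq> V" by auto
  moreover have "\<forall>x \<in> set (map fst ys @ map snd ys). ?l x = d"
    unfolding ys[symmetric] by auto
  then have "successively (\<lambda>x y. R x y \<and> ?l x = ?l y \<or> x = y) (map fst ys @ map snd ys)"
    by (intro successively_mono[OF filtered[unfolded ys]]) auto
  moreover have "\<forall>(a, b) \<in> set ys. \<phi> a = \<phi> b"
    using sub col \<psi> by blast
  ultimately have "\<exists>(a, b) \<in> set ys. a = b"
    by (rule strongly_nonrepetitiveD[OF \<phi>])
  with sub show "\<exists>(a, b) \<in> set zs. a = b" by blast
qed

lemma elimination_order_colouring:
  assumes "finite V" "elimination_order V R pos k" "\<And>u v. R u v \<Longrightarrow> R v u"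
  shows "\<exists>\<phi> :: 'a \<Rightarrow> nat. \<phi> ` V \<subseteq> {..<4 ^ k} \<and> strongly_nonrepetitive V R \<phi>"
  using assms(2,3)
proof (induction k arbitrary: R)
  case 0
  have "earlier V R pos v = {}" if "v \<in> V" for v
  proof -
    have "finite (earlier V R pos v)" using assms(1) by (simp add: earlier_def)
    moreover have "card (earlier V R pos v) = 0" using 0(1) that by (simp add: elimination_order_def)
    ultimately show ?thesis by simp
  qed
  \<comment> \<open>Without earlier neighbours only equal vertices can be related, so every lazy
    walk is constant and one colour suffices.\<close>
  then have R: "u = v" if "R u v" "u \<in> V" "v \<in> V" for u v
    using earlier_cases[OF 0 that] that by blast
  have "strongly_nonrepetitive V R (\<lambda>_. 0 :: nat)"
  proof (rule strongly_nonrepetitiveI)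
    fix zs
    assume "zs \<noteq> []" and V: "set (map fst zs @ map snd zs) \<subseteq> V"
      and walk: "successively (\<lambda>x y. R x y \<or> x = y) (map fst zs @ map snd zs)"
    have "successively (=) (map fst zs @ map snd zs)"
      by (rule successively_mono[OF walk]) (use R V in blast)
    from successively_eq_imp_eq[OF this] have "fst (hd zs) = snd (hd zs)"
      using \<open>zs \<noteq> []\<close> by (metis UnCI hd_in_set image_eqI list.set_map set_append)
    with \<open>zs \<noteq> []\<close> show "\<exists>(a, b) \<in> set zs. a = b"
      by (intro bexI[of _ "hd zs"]) (auto simp: case_prod_beta)
  qed
  then show ?case by (intro exI[of _ "\<lambda>_. 0"]) auto
next
  case (Suc k)
  let ?l = "layer V R pos"
  obtain \<phi> :: "'a \<Rightarrow> nat" where \<phi>: "\<phi> ` V \<subseteq> {..<4 ^ k}"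
      "strongly_nonrepetitive V (\<lambda>u v. R u v \<and> ?l u = ?l v) \<phi>"
    using Suc.IH[OF elimination_order_layer[OF assms(1) Suc.prems(1)]] Suc.prems(2) by auto
  \<comment> \<open>The product colouring is coded in base 4, with the letter of the layer as last
    digit.\<close>
  define \<psi> where "\<psi> v = 4 * \<phi> v + path_word (?l v)" for v
  have \<psi>: "\<psi> v div 4 = \<phi> v" "\<psi> v mod 4 = path_word (?l v)" for v
    using path_word_less[of "?l v"] by (simp_all add: \<psi>_def)
  then have "strongly_nonrepetitive V R \<psi>"
    by (intro strongly_nonrepetitive_layers[OF assms(1) Suc.prems \<phi>(2)]) metis+
  moreover have "\<psi> v < 4 ^ Suc k" if "v \<in> V" for v
  proof -
    have "\<phi> v < 4 ^ k" using \<phi>(1) that by auto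
    with path_word_less[of "?l v"] show ?thesis by (simp add: \<psi>_def)
  qed
  ultimately show ?case by blast
qed

section \<open>Treewidth\<close>

lemma treewidth_decomposition:
  assumes "simple_graph V E"
  obtains T :: "nat set" and TE B where "tree_decomposition V E T TE B"
    "\<And>x. x \<in> T \<Longrightarrow> card (B x) \<le> treewidth V E + 1"
proof -
  let ?P = "\<lambda>w. \<exists>(T::nat set) TE B. tree_decomposition V E T TE B \<and> (\<forall>x\<in>T. card (B x) \<le> w + 1)"
  have "\<not> is_cycle {0} (\<lambda>_ _. False) c" for c :: "nat list"
    by (simp add: is_cycle_def)
  \<comment> \<open>The single-node tree with bag \<open>V\<close> shows that the minimum defining
    the treewidth is taken over a nonempty set.\<close>
  then have "tree_decomposition V E {0::nat} (\<lambda>_ _. False) (\<lambda>_. V)"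
    using assms by (simp add: tree_decomposition_def is_tree_def simple_graph_def connected_on_def)
  then have "?P (card V)" by (intro exI[of _ "{0::nat}"] exI[of _ "\<lambda>_ _. False"] exI[of _ "\<lambda>_. V"]) simp
  then have "?P (treewidth V E)"
    unfolding treewidth_def by (rule LeastI)
  with that show thesis by blast
qed

theorem mainTheorem5:
  fixes V :: "'a set" and E :: "'a \<Rightarrow> 'a \<Rightarrow> bool" and k :: nat
  assumes "simple_graph V E"
    and "treewidth V E \<le> k"
  shows "pi_star V E \<le> 4 ^ k"
proof -
  obtain T :: "nat set" and TE B where dec: "tree_decomposition V E T TE B"
      and card: "\<And>x. x \<in> T \<Longrightarrow> card (B x) \<le> treewidth V E + 1"
    using treewidth_decomposition[OF assms(1)] by blast
  have V: "finite V" "\<Union>(B ` T) = V"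
    using assms(1) dec by (auto simp: simple_graph_def tree_decomposition_def)
  have tree: "finite T" "\<And>u v. TE u v \<Longrightarrow> TE v u" "\<nexists>c. is_cycle T TE c"
    using dec by (auto simp: tree_decomposition_def is_tree_def simple_graph_def)
  have bags: "finite (B x) \<and> card (B x) \<le> Suc k" if "x \<in> T" for x
    using card[OF that] assms(2) V that by (auto intro: finite_subset)
  \<comment> \<open>The decomposition speaks only of vertices in \<open>V\<close>; any other element
    lies in no bag, and the empty set is connected.\<close>
  have conn: "connected_on {x \<in> T. v \<in> B x} TE" for v
  proof (cases "v \<in> V")
    case True
    with dec show ?thesis by (simp add: tree_decomposition_def)
  next
    case False
    with V(2) have "{x \<in> T. v \<in> B x} = {}" by blast
    then show ?thesis unfolding connected_on_def by blast
  qed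
  obtain pos where "elimination_order V (share_bag T B) pos k"
    using forest_elimination_order[OF tree bags conn] V(2) by auto
  from elimination_order_colouring[OF V(1) this]
  obtain \<phi> :: "'a \<Rightarrow> nat" where \<phi>: "\<phi> ` V \<subseteq> {..<4 ^ k}" "strongly_nonrepetitive V (share_bag T B) \<phi>"
    by (auto simp: share_bag_def)
  \<comment> \<open>Every edge lies in a bag, so passing to the chordal graph only adds lazy walks,
    and a colouring good for it is good for the given graph.\<close>
  have "lazy_walk V (share_bag T B) ws" if "lazy_walk V E ws" for ws
    using that dec unfolding lazy_walk_def tree_decomposition_def share_bag_def by blast
  with \<phi>(2) have "strongly_nonrepetitive V E \<phi>"
    unfolding strongly_nonrepetitive_def by blast
  with \<phi>(1) show ?thesis
    unfolding pi_star_def by (intro Least_le) blast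
qed

end
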